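(* Let $\sigma \leq 1/2$ be a real number. Let $G$ be a finite simple graph such that every clique $K\subseteq V(G)$ contains at most $(1 - \sigma)(|K| - \sigma)$ simplicial vertices of $G$. Then \[ \alpha(G) \geq \sum_{v\in V(G)}\frac{1}{d(v) + 1 - \sigma}. \] In particular, if every clique $K\subseteq V(G)$ contains fewer than $|K|/2$ simplicial vertices of $G$, then $\alpha(G) \geq \sum_{v\in V(G)}1/(d(v) + 1/2)$; consequently, if moreover $G$ has $n\ge 1$ vertices and average degree $d$, then $\alpha(G) \geq n/(d + 1/2)$.
   Context: $\alpha(G)$ is the independence number of $G$ (the size of a largest independent set), and $d(v)$ is the degree of $v$ in $G$. A vertex is simplicial if its neighborhood induces a clique (in particular, a vertex of degree $0$ or $1$ is simplicial). *)

theory Defs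
  imports Complex_Main "HOL-Library.Ramsey"
begin

text \<open>
  A finite simple graph is given by a finite vertex set \<open>V\<close> and an edge set
  \<open>E \<subseteq> [V]\<^bsup>2\<^esup>\<close> of two-element subsets of \<open>V\<close>.  The predicates \<^const>\<open>clique\<close> and
  \<^const>\<open>indep\<close> from \<open>HOL-Library.Ramsey\<close> state that the vertices of a set are pairwise
  adjacent, respectively pairwise non-adjacent.
\<close>

definition neighborhood :: "'a set set \<Rightarrow> 'a \<Rightarrow> 'a set" where
  "neighborhood E v = {u. {u, v} \<in> E}"

definition degree :: "'a set set \<Rightarrow> 'a \<Rightarrow> nat" where
  "degree E v = card (neighborhood E v)"

definition average_degree :: "'a set \<Rightarrow> 'a set set \<Rightarrow> real" where
  "average_degree V E = (\<Sum>v\<in>V. real (degree E v)) / real (card V)"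

definition independence_number :: "'a set \<Rightarrow> 'a set set \<Rightarrow> nat" where
  "independence_number V E = Max (card ` {I. I \<subseteq> V \<and> indep I E})"

definition simplicial :: "'a set set \<Rightarrow> 'a \<Rightarrow> bool" where
  "simplicial E v \<longleftrightarrow> clique (neighborhood E v) E"

text \<open>
  The empty set is not counted as a clique here: a condition such as ``\<open>K\<close> contains fewer than
  \<open>\<bar>K\<bar> / 2\<close> simplicial vertices'' is never satisfied by \<open>K = {}\<close>.
\<close>

definition cliques :: "'a set \<Rightarrow> 'a set set \<Rightarrow> 'a set set" where
  "cliques V E = {K. K \<subseteq> V \<and> K \<noteq> {} \<and> clique K E}"

definition maximal_cliques :: "'a set \<Rightarrow> 'a set set \<Rightarrow> 'a set set" where
  "maximal_cliques V E = {K \<in> cliques V E. \<forall>L \<in> cliques V E. K \<subseteq> L \<longrightarrow> L = K}"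

definition simplicial_count :: "'a set set \<Rightarrow> 'a set \<Rightarrow> nat" where
  "simplicial_count E K = card {v \<in> K. simplicial E v}"

end

theory Submission
  imports Defs
begin

text \<open>
  Put \<open>f v = 1 / (d v + 1 - \<sigma>)\<close>.  Then \<open>f v * (d v + 1/2) \<le> 1\<close>, and the hypothesis says precisely that
  every clique has \<open>f\<close>-weight at most 1; these two properties already give an independent set of
  size at least the total weight of \<open>f\<close>.

  It is built greedily, always choosing a vertex \<open>t\<close> of minimum degree among the remaining vertices and
  deleting its closed neighbourhood.  If a neighbour of \<open>t\<close> was deleted before, the deleted weight is
  at most \<open>1 - f t / 2\<close>; otherwise it may be as large as \<open>1 + f t / 2\<close>.  In the latter case the closed
  neighbourhood of \<open>t\<close> is not a clique.  Let \<open>z\<close> be a neighbour of minimum degree that has a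
  non-neighbour in \<open>N t\<close>, delete only the common closed neighbourhood of \<open>t\<close> and \<open>z\<close>, and postpone the
  choice between \<open>t\<close> and \<open>z\<close>.  If a vertex \<open>y\<close> of \<open>N t - N z\<close> is chosen later, then \<open>z\<close> and \<open>y\<close> are
  taken together and pay for everything they dominate.  If a vertex adjacent to \<open>z\<close> or to such a \<open>y\<close> is
  chosen first, then \<open>t\<close> is taken, and the overlap of the neighbourhoods makes up for its excess.
\<close>

lemma neighborhood_sym: "u \<in> neighborhood E v \<longleftrightarrow> v \<in> neighborhood E u"
  by (simp add: neighborhood_def insert_commute)

section \<open>An elementary inequality\<close>

text \<open>Needed for a closed neighbourhood of weight above 1: \<open>q\<close> vertices have the
  minimum degree \<open>D\<close>, \<open>b\<close> have larger degree, \<open>F\<close> is the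
  weight of one of the latter and \<open>X\<close> that of all the rest. The excess forces
  \<open>2 * b < a\<close>.\<close>

lemma clique_excess_bound:
  fixes q b D m g F X :: real
  assumes "q \<ge> 1" "b \<ge> 1" "q + b = D + 1" "m * (D + 1/2) \<le> 1" "g * (D + 3/2) \<le> 1"
    and "X \<le> q * m + (b - 1) * g" "F \<le> g" "1 < X + F"
  shows "X \<le> 2 * q * F"
proof -
  define a where "a = D + 3/2"
  have a: "a \<ge> 5/2" "q = a - 1/2 - b" using assms(1-3) by (auto simp: a_def)
  have m: "m * (a - 1) \<le> 1" and g: "g * a \<le> 1"
    using assms(4,5) by (simp_all add: a_def add.commute)
  have pos: "0 < a * (a - 1)" using a by simp
  have qm: "q * m * (a * (a - 1)) \<le> q * a"
    using mult_left_mono[OF m, of "q * a"] a(1) assms(1) by (simp add: mult_ac)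
  have bg: "c * g * (a * (a - 1)) \<le> c * (a - 1)" if "c \<ge> 0" for c
    using mult_left_mono[OF g, of "c * (a - 1)"] a(1) that by (simp add: mult_ac)
  have "1 < q * m + b * g"
    using assms(6-8) by (simp add: algebra_simps)
  then have "a * (a - 1) < (q * m + b * g) * (a * (a - 1))"
    using mult_strict_right_mono[OF _ pos, of 1 "q * m + b * g"] by simp
  also have "\<dots> \<le> q * a + b * (a - 1)"
    unfolding distrib_right[of _ _ "a * (a - 1)"] using assms(2) by (intro add_mono qm bg) simp
  finally have ab: "2 * b < a"
    unfolding a(2) by (simp add: algebra_simps)
  have "X * (a * (a - 1)) \<le> (q * m + (b - 1) * g) * (a * (a - 1))"
    using assms(6) pos by (intro mult_right_mono) auto
  also have "\<dots> \<le> q * a + (b - 1) * (a - 1)"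
    unfolding distrib_right[of _ _ "a * (a - 1)"] using assms(2) by (intro add_mono qm bg) simp
  finally have X: "X * (a * (a - 1)) \<le> q * a + (b - 1) * (a - 1)" .
  \<comment> \<open>The target \<open>(2 * q + 1) * X \<le> 2 * q\<close> rearranges to
    \<open>X \<le> 2 * q * (1 - X)\<close>, and \<open>1 - X < F\<close>.\<close>
  have "(2 * q + 1) * X * (a * (a - 1)) \<le> (2 * q + 1) * (q * a + (b - 1) * (a - 1))"
    using mult_left_mono[OF X, of "2 * q + 1"] assms(1) by (simp add: mult_ac)
  also have "\<dots> = 2 * q * (a * (a - 1)) - (b - 1) * (a - 2 * b)"
    unfolding a(2) by (simp add: algebra_simps)
  also have "\<dots> \<le> 2 * q * (a * (a - 1))"
    using ab assms(2) by simp
  finally have "(2 * q + 1) * X \<le> 2 * q"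
    using pos by (rule mult_right_le_imp_le)
  moreover have "2 * q * (1 - X) \<le> 2 * q * F"
    using assms(1,8) by (intro mult_left_mono) auto
  ultimately show ?thesis by (simp add: algebra_simps)
qed

section \<open>Weighted graphs whose cliques weigh at most 1\<close>

locale demand_graph =
  fixes V :: "'a set" and E :: "'a set set" and f :: "'a \<Rightarrow> real"
  assumes finV: "finite V"
    and E_sub: "E \<subseteq> [V]\<^bsup>2\<^esup>"
    and f_nonneg: "\<And>v. 0 \<le> f v"
    and f_degree: "\<And>v. v \<in> V \<Longrightarrow> f v * (real (degree E v) + 1/2) \<le> 1"
    and f_antimono: "\<And>u v. u \<in> V \<Longrightarrow> v \<in> V \<Longrightarrow> degree E u \<le> degree E v \<Longrightarrow> f v \<le> f u"
    and f_clique: "\<And>K. K \<subseteq> V \<Longrightarrow> clique K E \<Longrightarrow> sum f K \<le> 1"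
begin

abbreviation N :: "'a \<Rightarrow> 'a set" where "N v \<equiv> neighborhood E v"

abbreviation d :: "'a \<Rightarrow> nat" where "d v \<equiv> degree E v"

definition cl :: "'a \<Rightarrow> 'a set" where "cl v = insert v (N v)"

lemma edge_iff: "{u, v} \<in> E \<longleftrightarrow> u \<in> N v"
  by (simp add: neighborhood_def)

lemma N_sub: "N v \<subseteq> V"
  using E_sub by (auto simp: neighborhood_def)

lemma N_irrefl: "v \<notin> N v"
  using E_sub by (auto simp: neighborhood_def nsets_def)

lemma finite_N [simp]: "finite (N v)"
  using N_sub finV finite_subset by blast

lemma finite_cl [simp]: "finite (cl v)"
  by (simp add: cl_def)

lemma cl_sub: "v \<in> V \<Longrightarrow> cl v \<subseteq> V"
  using N_sub by (auto simp: cl_def)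

lemma card_cl: "card (cl v) = Suc (d v)"
  by (simp add: cl_def degree_def N_irrefl)

lemma cl_sym: "u \<in> cl v \<longleftrightarrow> v \<in> cl u"
  using neighborhood_sym[of u E v] by (auto simp: cl_def)

lemma sum_le_card:
  assumes "finite X" "card X \<le> c" "\<And>u. u \<in> X \<Longrightarrow> f u \<le> b" "0 \<le> b"
  shows "sum f X \<le> b * real c"
proof -
  have "sum f X \<le> real (card X) * b"
    using assms(3) by (rule sum_bounded_above)
  also have "\<dots> \<le> real c * b"
    using assms(2,4) by (intro mult_right_mono) auto
  finally show ?thesis by (simp add: mult.commute)
qed

section \<open>Postponed choices and the greedy step\<close>

text \<open>
  A gadget is a postponed choice between the adjacent vertices \<open>v\<close> and \<open>z\<close>, where \<open>H\<close> is the set of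
  remaining vertices and still contains the neighbours of \<open>v\<close> outside \<open>N z\<close>.  The last clause says
  that \<open>z\<close> together with any one of these neighbours pays for everything they dominate.
\<close>

definition gadget :: "'a set \<Rightarrow> 'a \<Rightarrow> 'a \<Rightarrow> bool" where
  "gadget H v z \<longleftrightarrow> v \<in> V \<and> v \<notin> H \<and> z \<in> N v \<and> z \<notin> H \<and> N v \<inter> H \<noteq> {} \<and> N v \<inter> H \<inter> N z = {} \<and>
     (\<forall>u\<in>N v \<union> H. f u \<le> f v) \<and>
     (\<forall>t\<in>N v \<inter> H. sum f (cl v - H) +
        f t * real (card (N z - cl v) + card (cl t - (cl v - H))) \<le> 2)"

text \<open>Disjoint closed neighbourhoods let the gadgets be decided independently of each
  other.\<close>

definition state :: "'a set \<Rightarrow> 'a set \<Rightarrow> ('a \<Rightarrow> 'a) \<Rightarrow> bool" where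
  "state H A \<zeta> \<longleftrightarrow> H \<subseteq> V \<and> (\<forall>v\<in>A. gadget H v (\<zeta> v)) \<and>
     (\<forall>v\<in>A. \<forall>w\<in>A. v \<noteq> w \<longrightarrow> cl v \<inter> cl w = {})"

text \<open>The sum is the weight still unpaid: the remaining vertices and, for each gadget, the
  deleted part of \<open>cl v\<close>. Centres and partners lie outside \<open>H\<close> but may
  still be chosen.\<close>

definition solved :: "'a set \<Rightarrow> 'a set \<Rightarrow> ('a \<Rightarrow> 'a) \<Rightarrow> bool" where
  "solved H A \<zeta> \<longleftrightarrow> (\<exists>I \<subseteq> H \<union> A \<union> \<zeta> ` A. indep I E \<and>
     sum f H + (\<Sum>v\<in>A. sum f (cl v - H)) \<le> real (card I))"

text \<open>Since \<open>v \<notin> H\<close>, the set \<open>cl v - H\<close> depends on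
  \<open>H\<close> only through \<open>N v \<inter> H\<close>; deletions that miss
  \<open>N v\<close> leave a gadget intact.\<close>

lemma gadget_mono:
  assumes "gadget H v z" "H' \<subseteq> H" "N v \<inter> H' = N v \<inter> H"
  shows "gadget H' v z" "cl v - H' = cl v - H"
proof -
  show e: "cl v - H' = cl v - H"
    using assms unfolding gadget_def cl_def by blast
  show "gadget H' v z"
    using assms(1,2) unfolding gadget_def e assms(3) by blast
qed

text \<open>The \<open>d v\<close> vertices left weigh at most \<open>f v\<close> each. So a centre
  saves \<open>f v / 2\<close> once one of its neighbours is paid for elsewhere.\<close>

lemma cost_outside:
  assumes g: "gadget H v z" and y: "y \<in> N v"
  shows "sum f (cl v - {y}) \<le> 1 - f v / 2"
proof -
  have "card (cl v - {y}) = d v"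
    using y card_cl[of v] by (simp add: card_Diff_singleton cl_def del: card_insert_disjoint)
  moreover have "\<And>u. u \<in> cl v \<Longrightarrow> f u \<le> f v"
    using g by (auto simp: gadget_def cl_def)
  ultimately have "sum f (cl v - {y}) \<le> f v * real (d v)"
    by (intro sum_le_card) (auto simp: f_nonneg)
  moreover have "f v * real (d v) \<le> 1 - f v / 2"
    using f_degree[of v] g by (auto simp: gadget_def algebra_simps)
  ultimately show ?thesis by simp
qed

lemma state_finite: "state H A \<zeta> \<Longrightarrow> finite H \<and> finite A"
  unfolding state_def gadget_def
  by (meson finV finite_subset subsetI)

text \<open>
  One greedy step: the vertices of \<open>S\<close> are chosen.  The gadgets in \<open>D\<close> are decided in favour of
  their partner, which lies in \<open>S\<close>; those in \<open>T\<close>, where \<open>S\<close> dominates the partner or a remaining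
  neighbour, are decided in favour of their centre.
\<close>

lemma resolve:
  assumes st: "state H A \<zeta>"
    and IH: "\<And>H' A'. state H' A' \<zeta> \<Longrightarrow> card H' < card H \<Longrightarrow> solved H' A' \<zeta>"
    and t: "t \<in> H" "\<And>u. u \<in> H \<Longrightarrow> f u \<le> f t"
    and D: "D \<subseteq> A" and S: "t \<in> S" "finite S" "indep S E" "S \<subseteq> H \<union> \<zeta> ` D"
    and K_def: "K = (\<Union>s\<in>S. cl s)"
    and away: "\<And>v. v \<in> A - D \<Longrightarrow> v \<notin> K"
    and T_def: "T = {v \<in> A - D. N v \<inter> H \<inter> K \<noteq> {} \<or> \<zeta> v \<in> K}"
    and cost: "sum f (K \<inter> H) + f t * real (card {v \<in> T. N v \<inter> H \<inter> K = {}})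
        + (\<Sum>v\<in>D. sum f (cl v - H)) \<le> real (card S) + f t * real (card T) / 2"
  shows "solved H A \<zeta>"
proof -
  define H' where "H' = H - K - (\<Union>v\<in>T. N v)"
  define A' where "A' = A - D - T"
  have fin: "finite H" "finite A"
    using state_finite st by auto
  have TA: "T \<subseteq> A - D"
    by (auto simp: T_def)
  have finT: "finite T" "finite A'" "finite D" "finite H'"
    using fin TA D by (auto simp: A'_def H'_def intro: finite_subset)
  have gad: "\<And>v. v \<in> A \<Longrightarrow> gadget H v (\<zeta> v)"
    and disj: "\<And>v w. v \<in> A \<Longrightarrow> w \<in> A \<Longrightarrow> v \<noteq> w \<Longrightarrow> cl v \<inter> cl w = {}"
    using st by (auto simp: state_def)
  have keep: "N v \<inter> H' = N v \<inter> H" if "v \<in> A'" for v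
  proof -
    have "N v \<inter> N w = {}" if "w \<in> T" for w
      using disj[of v w] that TA \<open>v \<in> A'\<close> by (auto simp: A'_def cl_def)
    then show ?thesis
      using \<open>v \<in> A'\<close> unfolding H'_def A'_def T_def by blast
  qed
  have H'H: "H' \<subseteq> H"
    by (auto simp: H'_def)
  have "state H' A' \<zeta>"
    using st H'H gadget_mono(1)[OF gad H'H keep] by (auto simp: state_def A'_def)
  moreover have "card H' < card H"
    using t(1) S(1) fin(1) by (intro psubset_card_mono) (auto simp: H'_def K_def cl_def)
  ultimately obtain I' where I': "I' \<subseteq> H' \<union> A' \<union> \<zeta> ` A'" "indep I' E"
      "sum f H' + (\<Sum>v\<in>A'. sum f (cl v - H')) \<le> real (card I')"
    using IH unfolding solved_def by blast
  have SK: "S \<subseteq> K"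
    by (auto simp: K_def cl_def)
  have \<zeta>cl: "\<zeta> v \<in> cl v" if "v \<in> A" for v
    using gad[OF that] by (auto simp: gadget_def cl_def)
  have I'K: "I' \<inter> K = {}"
    using I'(1) away unfolding H'_def A'_def T_def by blast
  have I'T: "x \<notin> cl v" if "x \<in> I'" "v \<in> T" for x v
  proof
    assume x: "x \<in> cl v"
    have v: "v \<in> A" "v \<notin> H" "v \<notin> A'"
      using that(2) TA gad by (auto simp: gadget_def A'_def)
    have "x \<in> H' \<or> (\<exists>w\<in>A'. x \<in> cl w)"
      using that(1) I'(1) \<zeta>cl by (auto simp: A'_def cl_def)
    then show False
    proof
      assume "x \<in> H'"
      then show False using x v that(2) by (auto simp: H'_def cl_def)
    next
      assume "\<exists>w\<in>A'. x \<in> cl w"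
      then obtain w where "w \<in> A'" "x \<in> cl w" by blast
      then show False using disj[of v w] v x by (auto simp: A'_def)
    qed
  qed
  have TK: "v \<notin> K" if "v \<in> T" for v
    using that TA away by blast
  have Kst: "x \<in> K" if "s \<in> S" "x \<in> cl s" for x s
    using that by (auto simp: K_def)
  define I where "I = I' \<union> S \<union> T"
  have "x \<notin> N y" if "x \<in> I" "y \<in> I" "x \<noteq> y" for x y
  proof
    assume "x \<in> N y"
    then have xy: "x \<in> cl y" "y \<in> cl x" "x \<in> N y"
      using neighborhood_sym[of x E y] by (auto simp: cl_def)
    have TT: "\<not> (x \<in> T \<and> y \<in> T)"
      using disj[of x y] TA xy that(3) by (auto simp: cl_def)
    have II: "\<not> (x \<in> I' \<and> y \<in> I')" "\<not> (x \<in> S \<and> y \<in> S)"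
      using I'(2) S(3) xy(3) that(3) by (auto simp: indep_def edge_iff)
    show False
      using that(1,2) TT II I'T[of x y] I'T[of y x] TK[of x] TK[of y] Kst[of x y] Kst[of y x] I'K xy
      unfolding I_def by blast
  qed
  then have indI: "indep I E"
    by (auto simp: indep_def edge_iff)
  have I_sub: "I \<subseteq> H \<union> A \<union> \<zeta> ` A"
    using I'(1) S(4) D TA H'H unfolding I_def A'_def by blast
  have finI': "finite I'"
    using I'(1) finT by (meson finite_UnI finite_imageI finite_subset)
  have dj: "I' \<inter> S = {}" "(I' \<union> S) \<inter> T = {}"
    using I'K SK I'T TK by (auto simp: cl_def)
  have cardI: "card I = card I' + card S + card T"
    unfolding I_def using finI' S(2) finT dj by (simp add: card_Un_disjoint)
  \<comment> \<open>What taking the centre \<open>v\<close> still has to pay: \<open>cl v\<close>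
    without its part in \<open>K \<inter> H\<close>, which is accounted for in
    \<open>cost\<close>.\<close>
  define c where "c v = sum f (cl v - H) + sum f (N v \<inter> H - K)" for v
  \<comment> \<open>If \<open>K\<close> meets \<open>N v \<inter> H\<close>, then
    \<open>cost_outside\<close> leaves a slack of \<open>f v / 2 \<ge> f t / 2\<close>; otherwise
    one more vertex, of weight at most \<open>f t\<close>, is charged.\<close>
  have cT: "c v \<le> 1 + (if N v \<inter> H \<inter> K = {} then f t else 0) - f t / 2" if "v \<in> T" for v
  proof -
    have g: "gadget H v (\<zeta> v)" using gad that TA by auto
    have ft: "f t \<le> f v" using g t(1) by (auto simp: gadget_def)
    have ceq: "c v = sum f (cl v - (N v \<inter> H \<inter> K))"
      unfolding c_def using g
      by (subst sum.union_disjoint[symmetric])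
        (auto simp: cl_def gadget_def intro!: sum.cong)
    show ?thesis
    proof (cases "N v \<inter> H \<inter> K = {}")
      case False
      then obtain y where y: "y \<in> N v \<inter> H \<inter> K" by blast
      have "c v \<le> sum f (cl v - {y})"
        unfolding ceq using y by (intro sum_mono2) (auto simp: f_nonneg)
      also have "\<dots> \<le> 1 - f v / 2"
        using cost_outside[OF g] y by blast
      finally show ?thesis using False ft by auto
    next
      case True
      obtain y where y: "y \<in> N v" "y \<in> H" using g by (auto simp: gadget_def)
      have "c v = f y + sum f (cl v - {y})"
        unfolding ceq using True y by (simp add: sum.remove cl_def)
      also have "\<dots> \<le> f t + (1 - f v / 2)"
        using cost_outside[OF g y(1)] t(2)[OF y(2)] by simp
      finally show ?thesis using True ft by auto
    qed
  qed
  have "(\<Sum>v\<in>T. c v) \<le> (\<Sum>v\<in>T. 1 + (if N v \<inter> H \<inter> K = {} then f t else 0) - f t / 2)"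
    using cT by (rule sum_mono)
  also have "\<dots> = real (card T) + f t * real (card {v \<in> T. N v \<inter> H \<inter> K = {}}) - f t * real (card T) / 2"
    using finT(1) by (simp add: sum.distrib sum_subtractf sum.If_cases Int_def)
  finally have cT_sum: "(\<Sum>v\<in>T. c v) \<le> \<dots>" .
  have "sum f H = sum f H' + sum f (K \<inter> H) + (\<Sum>v\<in>T. sum f (N v \<inter> H - K))"
  proof -
    have "(\<Sum>v\<in>T. sum f (N v \<inter> H - K)) = sum f (\<Union>v\<in>T. N v \<inter> H - K)"
    proof (rule sum.UNION_disjoint[symmetric])
      show "\<forall>i\<in>T. \<forall>j\<in>T. i \<noteq> j \<longrightarrow> (N i \<inter> H - K) \<inter> (N j \<inter> H - K) = {}"
        using disj TA unfolding cl_def by blast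
    qed (use finT in auto)
    moreover have "sum f H = sum f (H' \<union> (K \<inter> H) \<union> (\<Union>v\<in>T. N v \<inter> H - K))"
      by (rule arg_cong[where f = "sum f"]) (auto simp: H'_def)
    moreover have "\<dots> = sum f H' + sum f (K \<inter> H) + sum f (\<Union>v\<in>T. N v \<inter> H - K)"
      using fin finT by (subst sum.union_disjoint, (auto simp: H'_def)[3])+ simp
    ultimately show ?thesis by simp
  qed
  moreover have "(\<Sum>v\<in>A. sum f (cl v - H)) = (\<Sum>v\<in>A'. sum f (cl v - H))
      + (\<Sum>v\<in>D. sum f (cl v - H)) + (\<Sum>v\<in>T. sum f (cl v - H))"
  proof -
    have "A = A' \<union> D \<union> T" using D TA by (auto simp: A'_def)
    then have "(\<Sum>v\<in>A. sum f (cl v - H)) = (\<Sum>v\<in>A' \<union> D \<union> T. sum f (cl v - H))" by simp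
    also have "\<dots> = (\<Sum>v\<in>A'. sum f (cl v - H))
      + (\<Sum>v\<in>D. sum f (cl v - H)) + (\<Sum>v\<in>T. sum f (cl v - H))"
      using finT TA by (subst sum.union_disjoint, (auto simp: A'_def)[3])+ simp
    finally show ?thesis .
  qed
  moreover have "(\<Sum>v\<in>A'. sum f (cl v - H)) = (\<Sum>v\<in>A'. sum f (cl v - H'))"
    using gadget_mono(2)[OF gad H'H keep] by (intro sum.cong) (auto simp: A'_def)
  moreover have "(\<Sum>v\<in>T. c v) = (\<Sum>v\<in>T. sum f (cl v - H)) + (\<Sum>v\<in>T. sum f (N v \<inter> H - K))"
    unfolding c_def by (rule sum.distrib)
  ultimately have "sum f H + (\<Sum>v\<in>A. sum f (cl v - H)) \<le> real (card I)"
    using cT_sum I'(3) cost unfolding cardI by simp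
  then show ?thesis
    unfolding solved_def using I_sub indI by blast
qed

section \<open>Creating a postponed choice\<close>

text \<open>This provides the last clause of \<open>gadget\<close> once
  \<open>cl v \<inter> cl z\<close> is deleted. If \<open>d z = d v\<close>, then \<open>v\<close>
  and \<open>z\<close> have equally many private neighbours; otherwise the minimum-degree vertices
  of \<open>cl v\<close> are common to all closed neighbourhoods involved.\<close>

lemma pair_cost:
  assumes v: "v \<in> V" and min: "\<And>u. u \<in> N v \<Longrightarrow> d v \<le> d u"
    and z: "z \<in> N v" and t: "t \<in> N v - cl z"
    and z_min: "\<And>x y. x \<in> N v \<Longrightarrow> y \<in> N v - cl x \<Longrightarrow> d z \<le> d x"
    and large: "1 < sum f (cl v)"
  shows "sum f (cl v \<inter> cl z) + f t * real (card (N z - cl v) + card (cl t - cl v \<inter> cl z)) \<le> 2"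
proof (cases "d z = d v")
  case True
  define k where "k = card (cl v - cl z)"
  have vz: "v \<in> cl z" "z \<in> cl v" "v \<in> cl t"
    using z t cl_sym by (auto simp: cl_def)
  have tV: "t \<in> V" using t N_sub by auto
  have k1: "k \<ge> 1"
    unfolding k_def using t by (simp add: Suc_le_eq card_gt_0_iff) (auto simp: cl_def)
  have cI: "card (cl v \<inter> cl z) + k = d v + 1"
    unfolding k_def using card_Int_Diff[of "cl v" "cl z"] card_cl[of v] by simp
  moreover have "card (cl v \<inter> cl z) + card (cl z - cl v) = d v + 1"
    using card_Int_Diff[of "cl z" "cl v"] card_cl[of z] True by (simp add: Int_commute)
  moreover have "N z - cl v = cl z - cl v"
    using vz by (auto simp: cl_def)
  ultimately have c1: "card (N z - cl v) = k" by simp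
  have "card (cl t - cl v \<inter> cl z) \<le> card (cl t - {v})"
    using vz by (intro card_mono) (auto simp: cl_def)
  also have "\<dots> = d t"
    using vz by (simp add: card_cl)
  finally have c2: "card (cl t - cl v \<inter> cl z) \<le> d t" .
  have fv: "f u \<le> f v" if "u \<in> cl v" for u
    using f_antimono[of v u] v that min N_sub by (auto simp: cl_def)
  then have ftv: "f t \<le> f v" using t by (simp add: cl_def)
  have "sum f (cl v \<inter> cl z) \<le> f v * real (d v + 1 - k)"
    using cI fv by (intro sum_le_card) (auto simp: f_nonneg)
  also have "real (d v + 1 - k) = real (d v) + 1 - real k" using cI by simp
  finally have s: "sum f (cl v \<inter> cl z) \<le> f v * (real (d v) + 1 - real k)" .
  have "f t * real (card (N z - cl v) + card (cl t - cl v \<inter> cl z)) \<le> f t * (real k + real (d t))"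
    using c1 c2 by (intro mult_left_mono) (auto simp: f_nonneg)
  \<comment> \<open>This bounds \<open>f v * (1 - k) + f t * k\<close> by
    \<open>f t\<close>.\<close>
  moreover have "0 \<le> (f v - f t) * (real k - 1)"
    using ftv k1 by simp
  ultimately show ?thesis
    using s f_degree[OF v] f_degree[OF tV] ftv by (simp add: algebra_simps)
next
  case False
  define Q where "Q = {x \<in> cl v. d x \<le> d v}"
  define C where "C = cl v - Q"
  have zV: "z \<in> V" and tV: "t \<in> V" using z t N_sub by auto
  have dz: "d v < d z" using False min[OF z] by simp
  have zt: "d z \<le> d t"
    using z_min[of t z] t z cl_sym by auto
  \<comment> \<open>A vertex of \<open>Q\<close> other than \<open>v\<close> with a non-neighbour in
    \<open>N v\<close> would contradict the choice of \<open>z\<close>, whose degree exceeds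
    \<open>d v\<close>.\<close>
  have QN: "Q \<subseteq> cl x" if "x \<in> N v" for x
  proof
    fix y assume y: "y \<in> Q"
    show "y \<in> cl x"
    proof (rule ccontr)
      assume n: "y \<notin> cl x"
      then have "y \<noteq> v" using that cl_sym by (auto simp: cl_def)
      then have "y \<in> N v" "x \<in> N v - cl y" using y that n cl_sym by (auto simp: Q_def cl_def)
      then show False using z_min[of y x] dz y by (auto simp: Q_def)
    qed
  qed
  have finQ: "finite Q" by (simp add: Q_def)
  have vQ: "v \<in> Q" by (simp add: Q_def cl_def)
  have q1: "card Q \<ge> 1"
    using vQ finQ by (simp add: Suc_le_eq card_gt_0_iff) blast
  have tC: "t \<in> C" using t zt dz by (auto simp: C_def Q_def cl_def)
  have b1: "card C \<ge> 1"
    using tC by (simp add: Suc_le_eq card_gt_0_iff C_def) blast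
  have qb: "card Q + card C = d v + 1"
    using card_Int_Diff[of "cl v" Q] card_cl[of v] Int_absorb1[of Q "cl v"] by (simp add: C_def Q_def)
  have zQ: "z \<notin> Q" using dz by (simp add: Q_def)
  have Qz: "Q \<subseteq> N z" using QN[OF z] zQ by (auto simp: cl_def)
  have "card (N z - cl v) \<le> card (N z - Q)"
    by (intro card_mono) (auto simp: Q_def)
  also have "\<dots> = d z - card Q"
    using Qz finQ by (simp add: card_Diff_subset degree_def)
  finally have c1: "card (N z - cl v) \<le> d z - card Q" .
  have Qdz: "card Q \<le> d z"
    unfolding degree_def using Qz by (intro card_mono) auto
  have "card (cl t - cl v \<inter> cl z) \<le> card (cl t - Q)"
    using QN[OF z] by (intro card_mono) (auto simp: Q_def)
  also have "\<dots> = d t + 1 - card Q"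
    using QN[of t] t finQ by (simp add: card_Diff_subset card_cl)
  finally have c2: "card (cl t - cl v \<inter> cl z) \<le> d t + 1 - card Q" .
  define X where "X = sum f (cl v - {t})"
  define g where "g = 1 / (real (d v) + 3/2)"
  have fC: "f u \<le> g" if "u \<in> C" for u
  proof -
    have "u \<in> V" "d v + 1 \<le> d u" using that cl_sub[OF v] by (auto simp: C_def Q_def)
    then have "f u * (real (d v) + 3/2) \<le> f u * (real (d u) + 1/2)"
      using f_nonneg by (intro mult_left_mono) auto
    then show ?thesis
      using f_degree[OF \<open>u \<in> V\<close>] by (simp add: g_def field_simps)
  qed
  have "X = sum f Q + sum f (C - {t})"
    unfolding X_def using tC
    by (subst sum.union_disjoint[symmetric]) (auto simp: C_def Q_def intro!: sum.cong)
  moreover have "sum f Q \<le> f v * real (card Q)"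
    using f_antimono v min cl_sub[OF v] finQ
    by (intro sum_le_card) (auto simp: f_nonneg Q_def cl_def)
  moreover have "sum f (C - {t}) \<le> g * real (card C - 1)"
    using fC tC by (intro sum_le_card) (auto simp: g_def C_def)
  ultimately have X: "X \<le> real (card Q) * f v + (real (card C) - 1) * g"
    using b1 by (simp add: of_nat_diff mult.commute)
  have "X + f t = sum f (cl v)"
    unfolding X_def using t by (subst (2) sum.remove[of _ t]) (auto simp: cl_def)
  \<comment> \<open>The second summand of the claim loses \<open>card Q\<close> twice, so it is at
    most \<open>2 - 2 * card Q * f t\<close>; the first has to fit into that gap.\<close>
  then have XF: "X \<le> 2 * real (card Q) * f t"
    using X q1 b1 qb f_degree[OF v] fC[OF tC] large
    by (intro clique_excess_bound[where b = "real (card C)" and D = "real (d v)" and m = "f v" and g = g])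
      (auto simp: g_def)
  have "sum f (cl v \<inter> cl z) \<le> X"
    unfolding X_def using t by (intro sum_mono2) (auto simp: f_nonneg)
  moreover have "f t * real (card (N z - cl v) + card (cl t - cl v \<inter> cl z))
      \<le> f t * (real (d z) + real (d t) + 1 - 2 * real (card Q))"
    using c1 c2 Qdz zt by (intro mult_left_mono) (auto simp: f_nonneg)
  moreover have "f t * real (d z) \<le> f t * real (d t)"
    using zt by (intro mult_left_mono) (auto simp: f_nonneg)
  ultimately show ?thesis
    using XF f_degree[OF tV] by (simp add: algebra_simps)
qed

text \<open>Weight above 1 rules out a clique, and \<open>v\<close> is adjacent to all of
  \<open>N v\<close>, so two neighbours of \<open>v\<close> are non-adjacent. Least degree among
  such neighbours is the minimality that \<open>pair_cost\<close> asks of \<open>z\<close>.\<close>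

lemma new_gadget:
  assumes H: "H \<subseteq> V" and v: "v \<in> H" "cl v \<subseteq> H" and min: "\<And>u. u \<in> H \<Longrightarrow> d v \<le> d u"
    and large: "1 < sum f (cl v)"
  obtains z where "z \<in> N v" "gadget (H - cl v \<inter> cl z) v z"
proof -
  define B where "B = {x \<in> N v. N v - cl x \<noteq> {}}"
  have "\<not> clique (cl v) E"
    using f_clique[of "cl v"] large v(2) H by auto
  then obtain x y where "x \<in> cl v" "y \<in> cl v" "x \<noteq> y" "x \<notin> N y"
    by (auto simp: clique_def edge_iff)
  then have "x \<in> B"
    using cl_sym[of x y] neighborhood_sym[of x E y] by (auto simp: B_def cl_def)
  then obtain z where z: "z \<in> B" "\<And>x. x \<in> B \<Longrightarrow> d z \<le> d x"
    using ex_has_least_nat[of "\<lambda>x. x \<in> B" x d] by blast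
  let ?H = "H - cl v \<inter> cl z"
  have vz: "v \<in> cl z" "z \<in> cl v" "z \<in> N v" "v \<in> V"
    using z(1) cl_sym v H by (auto simp: B_def cl_def)
  have NH: "N v \<inter> ?H = N v - cl z" and clH: "cl v - ?H = cl v \<inter> cl z"
    using v(2) by (auto simp: cl_def)
  have "sum f (cl v \<inter> cl z) + f t * real (card (N z - cl v) + card (cl t - cl v \<inter> cl z)) \<le> 2"
    if "t \<in> N v - cl z" for t
  proof (rule pair_cost[OF vz(4) _ vz(3) that _ large])
    show "d v \<le> d u" if "u \<in> N v" for u using that min v(2) by (auto simp: cl_def)
    show "d z \<le> d x" if "x \<in> N v" "y \<in> N v - cl x" for x y using that z(2) by (auto simp: B_def)
  qed
  moreover have "f u \<le> f v" if "u \<in> N v \<union> ?H" for u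
    using f_antimono[of v u] that min v H by (auto simp: cl_def)
  moreover have "N v - cl z \<noteq> {}" using z(1) by (auto simp: B_def)
  moreover have "N v \<inter> ?H \<inter> N z = {}" by (auto simp: cl_def)
  moreover have "v \<notin> ?H" "z \<notin> ?H" using vz by (auto simp: cl_def)
  ultimately have "gadget ?H v z"
    unfolding gadget_def NH clH using vz by blast
  then show thesis using that vz(3) by blast
qed

section \<open>The greedy induction\<close>

lemma state_inj: "state H A \<zeta> \<Longrightarrow> inj_on \<zeta> A"
proof (rule inj_onI, rule ccontr)
  fix v w
  assume "state H A \<zeta>" "v \<in> A" "w \<in> A" "\<zeta> v = \<zeta> w" "v \<noteq> w"
  then have "cl v \<inter> cl w = {}" "\<zeta> v \<in> N v" "\<zeta> v \<in> N w"
    by (auto simp: state_def gadget_def)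
  then show False by (auto simp: cl_def)
qed

lemma state_solved: "state H A \<zeta> \<Longrightarrow> solved H A \<zeta>"
proof (induction "card H" arbitrary: H A \<zeta> rule: less_induct)
  case less
  note st = less.prems
  have gad: "\<And>v. v \<in> A \<Longrightarrow> gadget H v (\<zeta> v)"
    and disj: "\<And>v w. v \<in> A \<Longrightarrow> w \<in> A \<Longrightarrow> v \<noteq> w \<Longrightarrow> cl v \<inter> cl w = {}"
    and HV: "H \<subseteq> V"
    using st by (auto simp: state_def)
  have fin: "finite H" "finite A" using state_finite[OF st] by auto
  have \<zeta>: "\<zeta> v \<in> cl v" "\<zeta> v \<notin> H" "v \<notin> H" if "v \<in> A" for v
    using gad[OF that] by (auto simp: gadget_def cl_def)
  show ?case
  proof (cases "H = {}")
    case True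
    then have "A = {}" using gad by (fastforce simp: gadget_def)
    then show ?thesis using True by (auto simp: solved_def indep_def)
  next
    case False
    then obtain t where t: "t \<in> H" "\<And>u. u \<in> H \<Longrightarrow> d t \<le> d u"
      using ex_has_least_nat[of "\<lambda>x. x \<in> H" _ d] by blast
    have tV: "t \<in> V" using t HV by auto
    have ft: "f u \<le> f t" if "u \<in> H" for u
      using f_antimono[of t u] t that HV by auto
    \<comment> \<open>Partners are distinct and lie outside \<open>H\<close>, so they and
      \<open>K \<inter> H\<close> are counted without overlap inside \<open>R\<close>, each at a
      price of at most \<open>f t\<close>.\<close>
    have count: "f t * real (card T) + sum f (K \<inter> H) \<le> f t * real c"
      if "T \<subseteq> A" "K \<inter> H \<subseteq> R" "\<zeta> ` T \<subseteq> R" "finite R" "card R \<le> c" for T K R c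
    proof -
      have "finite T" using that(1) fin(2) finite_subset by auto
      have "card T + card (K \<inter> H) = card (\<zeta> ` T) + card (K \<inter> H)"
        using state_inj[OF st] that(1) by (simp add: card_image inj_on_subset)
      also have "\<dots> = card (\<zeta> ` T \<union> K \<inter> H)"
        using \<zeta>(2) that(1) fin \<open>finite T\<close> by (intro card_Un_disjoint[symmetric]) auto
      also have "\<dots> \<le> c"
        using card_mono[of R "\<zeta> ` T \<union> K \<inter> H"] that by simp
      finally have "card T + card (K \<inter> H) \<le> c" .
      then have "f t * real (card T + card (K \<inter> H)) \<le> f t * real c"
        by (intro mult_left_mono) (auto simp: f_nonneg simp del: of_nat_add)
      moreover have "sum f (K \<inter> H) \<le> f t * real (card (K \<inter> H))"
        using ft fin by (intro sum_le_card) (auto simp: f_nonneg)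
      ultimately show ?thesis by (simp add: distrib_left)
    qed
    show ?thesis
    proof (cases "\<exists>g\<in>A. t \<in> N g")
      case True
      then obtain g where g: "g \<in> A" "t \<in> N g" by blast
      define z where "z = \<zeta> g"
      define K where "K = (\<Union>s\<in>{t, z}. cl s)"
      define T where "T = {v \<in> A - {g}. N v \<inter> H \<inter> K \<noteq> {} \<or> \<zeta> v \<in> K}"
      define T2 where "T2 = {v \<in> T. N v \<inter> H \<inter> K = {}}"
      \<comment> \<open>\<open>z\<close> contributes its neighbours outside \<open>cl g\<close>, and
        \<open>t\<close> its closed neighbourhood without the deleted part of \<open>cl g\<close>;
        the gadget inequality bounds the cost by 2, the size of \<open>{t, z}\<close>.\<close>
      define R where "R = (N z - cl g) \<union> (cl t - (cl g - H))"
      have gg: "z \<in> N g" "z \<notin> H" "g \<notin> H" "N g \<inter> H \<inter> N z = {}"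
        and gc: "sum f (cl g - H) + f t * real (card (N z - cl g) + card (cl t - (cl g - H))) \<le> 2"
        using gad[OF g(1)] g(2) t(1) by (auto simp: gadget_def z_def)
      have "t \<noteq> z" using gg t by auto
      have "f t * real (card T2) + sum f (K \<inter> H)
          \<le> f t * real (card (N z - cl g) + card (cl t - (cl g - H)))"
      proof (rule count)
        show "T2 \<subseteq> A" by (auto simp: T2_def T_def)
        show "finite R" "card R \<le> card (N z - cl g) + card (cl t - (cl g - H))"
          unfolding R_def by (auto intro: card_Un_le)
        show "K \<inter> H \<subseteq> R"
          using gg unfolding R_def K_def cl_def by blast
        show "\<zeta> ` T2 \<subseteq> R"
        proof
          fix x assume "x \<in> \<zeta> ` T2"
          then obtain v where v: "v \<in> A" "v \<noteq> g" "x = \<zeta> v" "x \<in> K"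
            by (auto simp: T2_def T_def)
          then have "x \<notin> cl g" using \<zeta>(1)[of v] disj[of v g] g by auto
          then show "x \<in> R" using v(4) gg by (auto simp: R_def K_def cl_def)
        qed
      qed
      moreover have "0 \<le> f t * real (card T) / 2" by (simp add: f_nonneg)
      ultimately have cost: "sum f (K \<inter> H) + f t * real (card T2)
          + (\<Sum>v\<in>{g}. sum f (cl v - H)) \<le> real (card {t, z}) + f t * real (card T) / 2"
        using gc \<open>t \<noteq> z\<close> by simp
      show ?thesis
      proof (rule resolve[OF st less.hyps t(1) ft _ _ _ _ _ K_def _ T_def cost[unfolded T2_def]])
        show "indep {t, z} E"
          using gg(4) g(2) t(1) neighborhood_sym[of t E z]
          by (auto simp: indep_def edge_iff insert_commute)
        show "v \<notin> K" if "v \<in> A - {g}" for v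
        proof -
          have "t \<in> cl g" "z \<in> cl g" using g gg by (auto simp: cl_def)
          then show ?thesis
            using disj[of v g] that g cl_sym[of v t] cl_sym[of v z] by (auto simp: K_def)
        qed
      qed (use g t in \<open>auto simp: z_def\<close>)
    next
      case nt: False
      define K where "K = (\<Union>s\<in>{t}. cl s)"
      define T where "T = {v \<in> A - {}. N v \<inter> H \<inter> K \<noteq> {} \<or> \<zeta> v \<in> K}"
      define T2 where "T2 = {v \<in> T. N v \<inter> H \<inter> K = {}}"
      have K: "K = cl t" by (simp add: K_def)
      have finT: "finite T" using fin by (simp add: T_def)
      show ?thesis
      proof (cases "sum f (K \<inter> H) + f t * real (card T2) \<le> 1 + f t * real (card T) / 2")
        case True
        show ?thesis
        proof (rule resolve[OF st less.hyps t(1) ft _ _ _ _ _ K_def _ T_def])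
          show "sum f (K \<inter> H) + f t * real (card {v \<in> T. N v \<inter> H \<inter> K = {}}) +
              (\<Sum>v\<in>{}. sum f (cl v - H)) \<le> real (card {t}) + f t * real (card T) / 2"
            using True by (simp add: T2_def)
          show "v \<notin> K" if "v \<in> A - {}" for v
            using nt that cl_sym[of v t] \<zeta>(3)[of v] t(1) by (auto simp: K cl_def)
        qed (use t in \<open>auto simp: indep_def\<close>)
      next
        case bad: False
        have count_cl: "f t * real (card T2) + sum f (K \<inter> H) \<le> f t * real (d t + 1)"
          by (rule count[where R = "cl t"]) (auto simp: T2_def T_def K card_cl)
        \<comment> \<open>The cost is at most \<open>f t * (d t + 1) \<le> 1 + f t / 2\<close>, and
          a single gadget in \<open>T\<close> already allows for the extra
          \<open>f t / 2\<close>.\<close>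
        have "T = {}"
        proof (rule ccontr)
          assume "T \<noteq> {}"
          then have "1 \<le> card T" using finT by (simp add: Suc_le_eq card_gt_0_iff)
          then have "f t * 1 \<le> f t * real (card T)"
            by (intro mult_left_mono) (auto simp: f_nonneg)
          then show False
            using bad count_cl f_degree[OF tV] by (simp add: algebra_simps)
        qed
        then have T2: "T2 = {}" by (simp add: T2_def)
        \<comment> \<open>If some vertex of \<open>cl t\<close> were gone, at most
          \<open>d t\<close> would be left to pay, and \<open>f t * d t \<le> 1\<close>.\<close>
        have clH: "cl t \<subseteq> H"
        proof (rule ccontr)
          assume n: "\<not> cl t \<subseteq> H"
          have "card (cl t \<inter> H) < card (cl t)"
            using n by (intro psubset_card_mono) auto
          then have "f t * real (card T2) + sum f (K \<inter> H) \<le> f t * real (d t)"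
            by (intro count[where R = "cl t \<inter> H"]) (auto simp: T2 K card_cl)
          then show False
            using bad T2 \<open>T = {}\<close> f_degree[OF tV] f_nonneg[of t] by (simp add: algebra_simps)
        qed
        have "1 < sum f (cl t)"
          using bad T2 \<open>T = {}\<close> Int_absorb2[OF clH] by (simp add: K)
        then obtain z where z: "z \<in> N t" "gadget (H - cl t \<inter> cl z) t z"
          using new_gadget[OF HV t(1) clH t(2)] by blast
        \<comment> \<open>The set \<open>cl t \<inter> cl z\<close> only moves from \<open>H\<close>
          to the account of the new gadget; the total in \<open>solved\<close> stays the same, and
          the same \<open>I\<close> serves.\<close>
        define H' where "H' = H - cl t \<inter> cl z"
        define \<zeta>' where "\<zeta>' = \<zeta>(t := z)"
        have tA: "t \<notin> A" using \<zeta>(3) t(1) by auto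
        have sep: "N v \<inter> H \<inter> cl t = {}" if "v \<in> A" for v
          using \<open>T = {}\<close> that by (auto simp: T_def K)
        have keep: "gadget H' v (\<zeta> v)" "cl v - H' = cl v - H" if "v \<in> A" for v
          using gadget_mono[OF gad[OF that], of H'] sep[OF that] by (auto simp: H'_def)
        have disj': "cl v \<inter> cl t = {}" if "v \<in> A" for v
          using sep[OF that] \<zeta>(3)[OF that] clH by (auto simp: cl_def)
        have "state H' (insert t A) \<zeta>'"
          unfolding state_def
        proof (intro conjI ballI impI)
          show "H' \<subseteq> V" using HV by (auto simp: H'_def)
          show "gadget H' v (\<zeta>' v)" if "v \<in> insert t A" for v
            using that z(2) keep(1) tA by (auto simp: \<zeta>'_def H'_def)
          show "cl v \<inter> cl w = {}" if "v \<in> insert t A" "w \<in> insert t A" "v \<noteq> w" for v w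
            using that disj disj' by blast
        qed
        moreover have "card H' < card H"
          using t(1) z(1) cl_sym[of z t] fin
          by (intro psubset_card_mono) (auto simp: H'_def cl_def)
        ultimately have "solved H' (insert t A) \<zeta>'"
          using less.hyps by blast
        then obtain I where I: "I \<subseteq> H' \<union> insert t A \<union> \<zeta>' ` insert t A" "indep I E"
            "sum f H' + (\<Sum>v\<in>insert t A. sum f (cl v - H')) \<le> real (card I)"
          unfolding solved_def by blast
        have "I \<subseteq> H \<union> A \<union> \<zeta> ` A"
        proof -
          have "\<zeta>' ` insert t A \<subseteq> H \<union> \<zeta> ` A"
            using z(1) clH tA by (auto simp: \<zeta>'_def cl_def)
          then show ?thesis using I(1) t(1) by (auto simp: H'_def)
        qed
        moreover have "sum f H + (\<Sum>v\<in>A. sum f (cl v - H)) \<le> real (card I)"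
        proof -
          have "sum f H = sum f H' + sum f (cl t - H')"
            using fin clH by (subst sum.union_disjoint[symmetric])
              (auto simp: H'_def intro!: sum.cong)
          moreover have "(\<Sum>v\<in>A. sum f (cl v - H')) = (\<Sum>v\<in>A. sum f (cl v - H))"
            using keep(2) by simp
          ultimately show ?thesis
            using I(3) fin tA by simp
        qed
        ultimately show ?thesis using I(2) unfolding solved_def by blast
      qed
    qed
  qed
qed

lemma sum_le_independence_number: "sum f V \<le> real (independence_number V E)"
proof -
  \<comment> \<open>The process starts without gadgets; \<open>id\<close> is a placeholder partner
    map.\<close>
  have "solved V {} id"
    by (rule state_solved) (simp add: state_def)
  then obtain I where I: "I \<subseteq> V" "indep I E" "sum f V \<le> real (card I)"
    by (auto simp: solved_def)
  have "finite {I. I \<subseteq> V \<and> indep I E}"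
    using finV by simp
  then have "card I \<le> independence_number V E"
    unfolding independence_number_def using I by (intro Max_ge) auto
  then show ?thesis using I(3) by simp
qed

end

section \<open>From the clique hypothesis to weights\<close>

lemma clique_in_maximal:
  assumes "finite V" "K \<in> cliques V E"
  obtains L where "L \<in> maximal_cliques V E" "K \<subseteq> L"
proof -
  have fin: "finite (cliques V E)"
    using assms(1) by (simp add: cliques_def)
  obtain L where "L \<in> cliques V E" "K \<subseteq> L" "\<forall>M\<in>cliques V E. L \<subseteq> M \<longrightarrow> L = M"
    using finite_has_maximal2[OF fin assms(2)] by auto
  then have "L \<in> maximal_cliques V E" by (auto simp: maximal_cliques_def)
  then show thesis using that \<open>K \<subseteq> L\<close> by blast
qed

lemma finite_neighborhood:
  assumes "finite V" "E \<subseteq> [V]\<^bsup>2\<^esup>"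
  shows "finite (neighborhood E v)"
  by (rule finite_subset[OF _ assms(1)]) (use assms(2) in \<open>auto simp: neighborhood_def\<close>)

lemma clique_subset_neighborhood:
  assumes "clique L E" "v \<in> L"
  shows "L - {v} \<subseteq> neighborhood E v"
  using assms unfolding clique_def neighborhood_def by blast

text \<open>
  In a clique of size \<open>k\<close> the simplicial vertices have degree at least \<open>k - 1\<close> and the others
  degree at least \<open>k\<close>; the hypothesis is exactly what bounds the resulting weight by 1.
\<close>

lemma clique_weight:
  fixes \<sigma> :: real
  assumes "finite V" "E \<subseteq> [V]\<^bsup>2\<^esup>" "\<sigma> \<le> 1/2"
    and L: "L \<subseteq> V" "L \<noteq> {}" "clique L E"
    and hyp: "real (simplicial_count E L) \<le> (1 - \<sigma>) * (real (card L) - \<sigma>)"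
  shows "(\<Sum>v\<in>L. 1 / (real (degree E v) + 1 - \<sigma>)) \<le> 1"
proof -
  have finL: "finite L" using L(1) assms(1) finite_subset by blast
  define S where "S = {v \<in> L. simplicial E v}"
  define k where "k = real (card L)"
  define s where "s = real (card S)"
  have k: "k \<ge> 1" using L(2) finL by (simp add: k_def Suc_le_eq card_gt_0_iff)
  have deg: "k \<le> real (degree E v) + 1" "v \<notin> S \<Longrightarrow> k \<le> real (degree E v)" if v: "v \<in> L" for v
  proof -
    have finN: "finite (neighborhood E v)" using assms(1,2) by (rule finite_neighborhood)
    note sub = clique_subset_neighborhood[OF L(3) v]
    have "card (L - {v}) \<le> degree E v"
      unfolding degree_def by (rule card_mono[OF finN sub])
    then show "k \<le> real (degree E v) + 1"
      using v finL by (simp add: k_def)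
    \<comment> \<open>Otherwise \<open>L - {v}\<close> would be the whole neighbourhood of
      \<open>v\<close>, making \<open>v\<close> simplicial.\<close>
    show "k \<le> real (degree E v)" if "v \<notin> S"
    proof (rule ccontr)
      assume "\<not> k \<le> real (degree E v)"
      then have "degree E v \<le> card (L - {v})" using v finL by (simp add: k_def)
      then have "L - {v} = neighborhood E v"
        unfolding degree_def using finN sub by (intro card_seteq)
      then have "clique (neighborhood E v) E"
        using L(3) unfolding clique_def by blast
      then show False using \<open>v \<notin> S\<close> v by (simp add: S_def simplicial_def)
    qed
  qed
  have "(\<Sum>v\<in>L. 1 / (real (degree E v) + 1 - \<sigma>))
      = (\<Sum>v\<in>S. 1 / (real (degree E v) + 1 - \<sigma>)) + (\<Sum>v\<in>L - S. 1 / (real (degree E v) + 1 - \<sigma>))"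
    using finL by (subst sum.union_disjoint[symmetric]) (auto simp: S_def intro!: sum.cong)
  also have "\<dots> \<le> (\<Sum>v\<in>S. 1 / (k - \<sigma>)) + (\<Sum>v\<in>L - S. 1 / (k + 1 - \<sigma>))"
  proof (intro add_mono sum_mono frac_le)
    fix v assume v: "v \<in> S"
    then show "k - \<sigma> \<le> real (degree E v) + 1 - \<sigma>" using deg[of v] by (simp add: S_def)
  next
    fix v assume v: "v \<in> L - S"
    then show "k + 1 - \<sigma> \<le> real (degree E v) + 1 - \<sigma>" using deg[of v] by simp
  qed (use k assms(3) in auto)
  also have "\<dots> = s / (k - \<sigma>) + (k - s) / (k + 1 - \<sigma>)"
    using finL by (simp add: card_Diff_subset of_nat_diff card_mono s_def k_def S_def)
  \<comment> \<open>In this form the bound 1 amounts to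
    \<open>s / (k - \<sigma>) \<le> 1 - \<sigma>\<close>, which is the hypothesis on
    \<open>L\<close>.\<close>
  also have "\<dots> = (s / (k - \<sigma>) + k) / (k + 1 - \<sigma>)"
    using k assms(3) by (simp add: divide_simps) (simp add: algebra_simps)
  also have "\<dots> \<le> 1"
  proof -
    have "s / (k - \<sigma>) \<le> 1 - \<sigma>"
      using hyp k assms(3) by (simp add: s_def S_def k_def simplicial_count_def pos_divide_le_eq)
    then show ?thesis using k assms(3) by simp
  qed
  finally show ?thesis .
qed

text \<open>Weights are nonnegative, so a clique weighs at most as much as a maximal clique
  containing it.\<close>

lemma independence_number_ge:
  fixes \<sigma> :: real
  assumes "finite V" "E \<subseteq> [V]\<^bsup>2\<^esup>" "\<sigma> \<le> 1/2"
    and hyp: "\<And>K. K \<in> maximal_cliques V E \<Longrightarrow>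
      real (simplicial_count E K) \<le> (1 - \<sigma>) * (real (card K) - \<sigma>)"
  shows "(\<Sum>v\<in>V. 1 / (real (degree E v) + 1 - \<sigma>)) \<le> real (independence_number V E)"
proof -
  define f where "f v = 1 / (real (degree E v) + 1 - \<sigma>)" for v
  have f_nonneg: "0 \<le> f v" for v using assms(3) by (simp add: f_def)
  interpret demand_graph V E f
  proof
    show "f v * (real (degree E v) + 1/2) \<le> 1" for v
      using assms(3) by (simp add: f_def divide_simps)
    show "f v \<le> f u" if "degree E u \<le> degree E v" for u v
      unfolding f_def using that assms(3) by (intro frac_le) auto
    show "sum f K \<le> 1" if K: "K \<subseteq> V" "clique K E" for K
    proof (cases "K = {}")
      case False
      then have "K \<in> cliques V E" using K by (simp add: cliques_def)
      then obtain L where L: "L \<in> maximal_cliques V E" "K \<subseteq> L"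
        using clique_in_maximal assms(1) by blast
      then have L': "L \<subseteq> V" "L \<noteq> {}" "clique L E"
        by (auto simp: maximal_cliques_def cliques_def)
      have "finite L"
        using L'(1) assms(1) by (rule finite_subset)
      then have "sum f K \<le> sum f L"
        using L(2) f_nonneg by (intro sum_mono2) auto
      also have "\<dots> \<le> 1"
        using clique_weight[OF assms(1-3) L' hyp[OF L(1)]] by (simp add: f_def)
      finally show ?thesis .
    qed simp
  qed (use assms f_nonneg in auto)
  show ?thesis
    using sum_le_independence_number by (simp add: f_def)
qed

section \<open>The average-degree bound\<close>

text \<open>The inequality of arithmetic and harmonic means: \<open>1 / x\<close> lies above its
  tangent \<open>2 / c - x / c\<^sup>2\<close> at the mean \<open>c\<close>, and the tangent values
  add up to \<open>n / c\<close>.\<close>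

lemma sum_inverse_ge_mean:
  fixes g :: "'a \<Rightarrow> real"
  assumes "finite V" "V \<noteq> {}" "\<And>v. v \<in> V \<Longrightarrow> 0 < g v"
  shows "real (card V) / (sum g V / real (card V)) \<le> (\<Sum>v\<in>V. 1 / g v)"
proof -
  define n where "n = real (card V)"
  define c where "c = sum g V / n"
  have n: "n > 0" using assms(1,2) by (simp add: n_def card_gt_0_iff)
  have c: "c > 0" using assms n by (simp add: c_def sum_pos)
  have "n / c = (\<Sum>v\<in>V. 2 / c - g v / c\<^sup>2)"
  proof -
    have "(\<Sum>v\<in>V. 2 / c - g v / c\<^sup>2) = n * (2 / c) - n * c / c\<^sup>2"
      using n by (simp add: sum_subtractf sum_divide_distrib[symmetric] c_def n_def)
    also have "\<dots> = n / c" using c by (simp add: power2_eq_square)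
    finally show ?thesis by simp
  qed
  also have "\<dots> \<le> (\<Sum>v\<in>V. 1 / g v)"
  proof (rule sum_mono)
    fix v assume "v \<in> V"
    then have g: "g v > 0" using assms(3) by blast
    have "1 / g v - (2 / c - g v / c\<^sup>2) = (g v - c)\<^sup>2 / (g v * c\<^sup>2)"
      using g c by (simp add: field_simps power2_eq_square)
    also have "\<dots> \<ge> 0" using g c by simp
    finally show "2 / c - g v / c\<^sup>2 \<le> 1 / g v" by simp
  qed
  finally show ?thesis by (simp add: c_def n_def)
qed

(* The family C over which the clique hypotheses range is either the family of all (nonempty)
   cliques or the family of inclusion-maximal ones; the claim is made for both readings of
   "every clique".  The second reading has the weaker hypotheses. *)
theorem theorem1p3:
  fixes V :: "'a set" and E :: "'a set set" and C :: "'a set set"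
  assumes "finite V" and "E \<subseteq> [V]\<^bsup>2\<^esup>"
    and "C = cliques V E \<or> C = maximal_cliques V E"
  shows
    "(\<forall>\<sigma>::real. \<sigma> \<le> 1/2 \<longrightarrow>
        (\<forall>K\<in>C. real (simplicial_count E K) \<le> (1 - \<sigma>) * (real (card K) - \<sigma>)) \<longrightarrow>
        real (independence_number V E) \<ge> (\<Sum>v\<in>V. 1 / (real (degree E v) + 1 - \<sigma>)))
   \<and> ((\<forall>K\<in>C. real (simplicial_count E K) < real (card K) / 2) \<longrightarrow>
        real (independence_number V E) \<ge> (\<Sum>v\<in>V. 1 / (real (degree E v) + 1/2)))
   \<and> ((\<forall>K\<in>C. real (simplicial_count E K) < real (card K) / 2) \<and> card V \<ge> 1 \<longrightarrow>
        real (independence_number V E) \<ge> real (card V) / (average_degree V E + 1/2))"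
proof -
  have sub: "maximal_cliques V E \<subseteq> C"
    using assms(3) by (auto simp: maximal_cliques_def)
  have one: "(\<Sum>v\<in>V. 1 / (real (degree E v) + 1 - \<sigma>)) \<le> real (independence_number V E)"
    if "\<sigma> \<le> 1/2" "\<forall>K\<in>C. real (simplicial_count E K) \<le> (1 - \<sigma>) * (real (card K) - \<sigma>)" for \<sigma>
    using independence_number_ge[OF assms(1,2)] that sub by blast
  have two: "(\<Sum>v\<in>V. 1 / (real (degree E v) + 1/2)) \<le> real (independence_number V E)"
    if half: "\<forall>K\<in>C. real (simplicial_count E K) < real (card K) / 2"
  proof -
    \<comment> \<open>For \<sigma> = 1/2 the gap between \<open>2 * simplicial_count E K\<close> and
      \<open>card K\<close> must be at least 1/2; by integrality it is at least 1.\<close>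
    have "real (simplicial_count E K) \<le> (1 - 1/2) * (real (card K) - 1/2)" if "K \<in> C" for K
    proof -
      have "2 * simplicial_count E K < card K" using half that by fastforce
      then have "2 * real (simplicial_count E K) + 1 \<le> real (card K)" by linarith
      then show ?thesis by simp
    qed
    then show ?thesis using one[of "1/2"] by (simp add: add.commute)
  qed
  have three: "real (card V) / (average_degree V E + 1/2) \<le> real (independence_number V E)"
    if "\<forall>K\<in>C. real (simplicial_count E K) < real (card K) / 2" "card V \<ge> 1"
  proof -
    have V: "V \<noteq> {}" using that(2) by auto
    have "average_degree V E + 1/2 = (\<Sum>v\<in>V. real (degree E v) + 1/2) / real (card V)"
      using that(2) by (simp add: average_degree_def sum.distrib add_divide_distrib)
    then show ?thesis
      using sum_inverse_ge_mean[OF assms(1) V, of "\<lambda>v. real (degree E v) + 1/2"] two[OF that(1)]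
      by simp
  qed
  show ?thesis using one two three by blast
qed

end
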